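(* Let $\beta_1,\beta_2>0$ be real numbers with $2\beta_1-\beta_2\geq \sqrt{2}\,\pi$. Let $p$ be an analytic function in $\mathbb{D}$ with $p(0)=1$ and $$1+\beta_1 zp'(z)+\beta_2 z^2p''(z)\prec 1+\sinh^{-1}z.$$ Then $p(z)\prec 1+\sinh^{-1}z$.
   Context: $\mathbb{D}=\{z\in\mathbb{C}:|z|<1\}$. For functions $f,g$ analytic in $\mathbb{D}$, $f\prec g$ ($f$ is subordinate to $g$) means there is an analytic $w:\mathbb{D}\to\mathbb{C}$ with $w(0)=0$ and $|w(z)|\leq|z|$ such that $f(z)=g(w(z))$ for all $z\in\mathbb{D}$. $\sinh^{-1}z=\log(z+\sqrt{1+z^2})$ is the principal branch of the inverse hyperbolic sine, analytic on $\mathbb{D}$ with value $0$ at $0$. *)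

theory Defs
  imports "HOL-Complex_Analysis.Complex_Analysis"
begin

definition subordinate :: "(complex \<Rightarrow> complex) \<Rightarrow> (complex \<Rightarrow> complex) \<Rightarrow> bool"
    (infix "\<prec>\<^sub>D" 50) where
  "f \<prec>\<^sub>D g \<longleftrightarrow>
     (\<exists>w. w holomorphic_on ball 0 1 \<and> w 0 = 0 \<and>
          (\<forall>z\<in>ball 0 1. norm (w z) \<le> norm z) \<and>
          (\<forall>z\<in>ball 0 1. f z = g (w z)))"

text \<open>At type \<^typ>\<open>complex\<close>, the library's \<^const>\<open>arsinh\<close> is the principal branch of the
  inverse hyperbolic sine:\<close>

lemma arsinh_complex_eq: "arsinh z = Ln (z + csqrt (1 + z\<^sup>2))" for z :: complex
  by (simp add: arsinh_def csqrt_conv_powr add.commute)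

lemma arsinh_complex_0: "arsinh (0 :: complex) = 0"
  by (simp add: arsinh_complex_eq)

lemma holomorphic_arsinh: "(arsinh :: complex \<Rightarrow> complex) holomorphic_on ball 0 1"
proof -
  have "(\<lambda>z. \<i> * Arcsin (- \<i> * z)) holomorphic_on ball 0 1"
  proof (intro holomorphic_intros holomorphic_on_compose_gen
      [OF _ holomorphic_on_Arcsin, unfolded o_def, where t = "ball 0 1"])
    fix z :: complex
    assume "z \<in> ball 0 1"
    then show "\<bar>Re z\<bar> < 1"
      using abs_Re_le_cmod [of z] by simp
  qed (auto simp: norm_mult)
  moreover have "arsinh = (\<lambda>z. \<i> * Arcsin (- \<i> * z))"
    by (simp add: fun_eq_iff arsinh_complex_eq Arcsin_def power_mult_distrib)
  ultimately show ?thesis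
    by simp
qed

end

theory Submission
  imports Defs
begin

text \<open>
  Write $H$ for the left-hand side of the hypothesis minus $1$. Jordan's inequality gives
  $|\sinh^{-1} w| \le \frac{\pi}{2} |w|$ on the unit disc, hence $|H(z)| \le \frac{\pi}{2} |z|$.
  With $a = \beta_1/\beta_2$ the equation reads
  $\frac{d}{dt}(t^a p'(tz)) = t^{a-1} H(tz) / (\beta_2 t z)$, so integrating over $[0,1]$ gives
  $|p'(z)| \le \pi/(2\beta_1) \le 1/\sqrt{2}$ and then $|p(z) - 1| \le |z|/\sqrt{2}$. On this small
  disc $\sinh$ is inverted by the principal branch and $|\sinh u| \le \sqrt{2}\,|u|$, so
  $w = \sinh(p - 1)$ is a subordination function.
\<close>

section \<open>Two-sided comparison of the complex sine with its argument\<close>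

text \<open>Separates the two coordinates of \<open>z\<close>, so that bounds on
  \<open>norm (sin z)\<close> reduce to real bounds on \<open>sin\<close> and
  \<open>sinh\<close>.\<close>

lemma norm_sin_complex_squared:
  fixes z :: complex
  shows "(norm (sin z))\<^sup>2 = (sin (Re z))\<^sup>2 + (sinh (Im z))\<^sup>2"
proof -
  have "sin (Re z)^2 = (1 - cos (2 * Re z)) / 2"
    using cos_double_sin[of "Re z"] by simp
  moreover have "sinh (Im z)^2 = (exp (2 * Im z) + inverse (exp (2 * Im z)) - 2) / 4"
    by (simp only: sinh_field_def exp_minus exp_double) (simp add: field_simps power2_eq_square)
  ultimately show ?thesis
    by (simp only: norm_sin_squared) (simp add: add_divide_distrib diff_divide_distrib)
qed

lemma abs_le_abs_sinh: "\<bar>x\<bar> \<le> \<bar>sinh x\<bar>" for x :: real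
proof -
  have *: "y \<le> sinh y" if "y \<ge> 0" for y :: real
  proof -
    have "sinh 0 - 0 \<le> sinh y - y"
      by (rule DERIV_nonneg_imp_nondecreasing[OF that, of "\<lambda>y. sinh y - y"])
         (auto intro!: exI derivative_eq_intros cosh_real_ge_1)
    then show ?thesis by simp
  qed
  show ?thesis
    using *[of x] *[of "-x"] by (cases "x \<ge> 0") auto
qed

text \<open>Half the difference of \<open>exp x \<le> 1 + x + x\<^sup>2\<close> and
  \<open>exp (-x) \<ge> 1 - x\<close>.\<close>

lemma sinh_le:
  fixes x :: real
  assumes "0 \<le> x" "x \<le> 1"
  shows "sinh x \<le> x + x\<^sup>2 / 2"
  using exp_bound[OF assms] exp_ge_add_one_self[of "-x"]
  by (simp add: sinh_field_def)

text \<open>By concavity, sine on \<open>{0..pi/2}\<close> lies above its chord from (0, 0) to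
  (pi/2, 1); oddness covers negative \<open>x\<close>.\<close>

lemma Jordan_sin_ge:
  fixes x :: real
  assumes "\<bar>x\<bar> \<le> pi / 2"
  shows "2 / pi * \<bar>x\<bar> \<le> \<bar>sin x\<bar>"
proof -
  have "concave_on {0..pi/2} sin"
    by (rule f''_le0_imp_concave[where f' = cos and f'' = "\<lambda>x. - sin x"])
       (auto intro!: derivative_eq_intros sin_ge_zero)
  from concave_onD_Icc'[OF this, of "\<bar>x\<bar>"] have "2 / pi * \<bar>x\<bar> \<le> sin \<bar>x\<bar>"
    using assms by (simp add: field_simps)
  then show ?thesis
    by (cases "x \<ge> 0") auto
qed

text \<open>Squares are compared coordinatewise: Jordan's inequality for the real part, and 2/pi
  \<le> 1 with \<open>abs_le_abs_sinh\<close> for the imaginary part.\<close>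

lemma norm_le_norm_sin:
  fixes z :: complex
  assumes "\<bar>Re z\<bar> \<le> pi / 2"
  shows "norm z \<le> pi / 2 * norm (sin z)"
proof -
  have "(2 / pi * norm z)\<^sup>2 = (2 / pi * Re z)\<^sup>2 + (2 / pi * Im z)\<^sup>2"
    by (simp only: cmod_power2 power_mult_distrib distrib_left)
  also have "\<dots> \<le> (sin (Re z))\<^sup>2 + (sinh (Im z))\<^sup>2"
  proof (intro add_mono)
    show "(2 / pi * Re z)\<^sup>2 \<le> (sin (Re z))\<^sup>2"
      using Jordan_sin_ge[OF assms] by (simp add: abs_le_square_iff[symmetric] abs_mult)
    have "\<bar>2 / pi * Im z\<bar> \<le> \<bar>Im z\<bar>"
      using mult_right_mono[OF pi_ge_two, of "\<bar>Im z\<bar>"] by (simp add: abs_mult field_simps)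
    then show "(2 / pi * Im z)\<^sup>2 \<le> (sinh (Im z))\<^sup>2"
      using abs_le_abs_sinh[of "Im z"] by (simp only: abs_le_square_iff[symmetric])
  qed
  also have "\<dots> = (norm (sin z))\<^sup>2"
    by (simp add: norm_sin_complex_squared)
  finally have "2 / pi * norm z \<le> norm (sin z)"
    by (rule power2_le_imp_le) simp
  then show ?thesis
    by (simp add: field_simps)
qed

lemma norm_sin_le:
  fixes z :: complex
  assumes "\<bar>Im z\<bar> \<le> 3 / 4"
  shows "norm (sin z) \<le> sqrt 2 * norm z"
proof (rule power2_le_imp_le)
  define y where "y = \<bar>Im z\<bar>"
  have y: "0 \<le> y" "y \<le> 3 / 4"
    using assms by (auto simp: y_def)
  have "sinh y \<le> y + y * y / 2"
    using sinh_le[of y] y by (simp add: power2_eq_square)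
  \<comment> \<open>Here 11/8 = 1 + (3/4)/2, and its square 121/64 is below 2.\<close>
  also have "\<dots> \<le> 11 / 8 * y"
    using mult_right_mono[OF y(2) y(1)] by simp
  finally have "(sinh y)\<^sup>2 \<le> (11 / 8 * y)\<^sup>2"
    using y by (intro power_mono) auto
  also have "\<dots> \<le> 2 * y\<^sup>2"
    by (simp add: power_mult_distrib power_divide)
  finally have "(sinh (Im z))\<^sup>2 \<le> 2 * (Im z)\<^sup>2"
    by (cases "Im z \<ge> 0") (auto simp: y_def)
  moreover have "(sin (Re z))\<^sup>2 \<le> (Re z)\<^sup>2"
    using abs_sin_x_le_abs_x by (simp add: abs_le_square_iff[symmetric])
  then have "(sin (Re z))\<^sup>2 \<le> 2 * (Re z)\<^sup>2"
    by (smt (verit) zero_le_power2)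
  ultimately show "(norm (sin z))\<^sup>2 \<le> (sqrt 2 * norm z)\<^sup>2"
    unfolding norm_sin_complex_squared
    unfolding power_mult_distrib cmod_power2 by simp
qed simp

lemma arsinh_conv_Arcsin: "arsinh z = \<i> * Arcsin (- \<i> * z)"
  by (simp add: arsinh_complex_eq Arcsin_def power_mult_distrib)

text \<open>\<open>Arcsin\<close> takes values in the strip where \<open>norm_le_norm_sin\<close>
  applies, so the lower bound for sine becomes an upper bound for its inverse.\<close>

lemma norm_arsinh_le:
  fixes z :: complex
  assumes "norm z < 1"
  shows "norm (arsinh z) \<le> pi / 2 * norm z"
proof -
  have "\<bar>Re (- \<i> * z)\<bar> < 1"
    using assms abs_Im_le_cmod[of z] by simp
  then have "\<bar>Re (Arcsin (- \<i> * z))\<bar> \<le> pi / 2"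
    using Arcsin_bounds less_imp_le by blast
  from norm_le_norm_sin[OF this] show ?thesis
    by (simp add: arsinh_conv_Arcsin norm_mult)
qed

section \<open>Integration along radii\<close>

text \<open>With the integrating factor \<open>t powr a\<close>, the bounded expression times
  \<open>t powr (a - 1)\<close> is the derivative of \<open>t powr a\<close> times
  \<open>f (t z)\<close>. It is dominated by the derivative of
  \<open>t powr a * M / a\<close>.\<close>

lemma norm_le_of_radial_ode_bound:
  fixes f :: "complex \<Rightarrow> complex"
  assumes "0 < a" and hol: "f holomorphic_on ball 0 r" and z: "norm z < r"
    and bnd: "\<And>t::real. 0 < t \<Longrightarrow> t < 1 \<Longrightarrow>
      norm (of_real a * f (of_real t * z) + of_real t * z * deriv f (of_real t * z)) \<le> M"
  shows "norm (f z) \<le> M / a"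
proof -
  have in_ball: "of_real t * z \<in> ball 0 r" if "0 \<le> t" "t \<le> 1" for t :: real
    using z that mult_left_le_one_le[of "norm z" t] by (simp add: norm_mult)
  \<comment> \<open>As \<open>0 powr a = 0\<close>, the value \<open>\<phi> 0\<close> vanishes, and
    \<open>\<phi> 1\<close> is \<open>f z\<close>.\<close>
  define \<phi> where "\<phi> t = (t powr a) *\<^sub>R f (of_real t * z)" for t :: real
  have cont_powr: "continuous_on {0..1} (\<lambda>t. t powr a)"
    using \<open>0 < a\<close> by (intro continuous_on_powr' continuous_intros) auto
  have "norm (\<phi> 1 - \<phi> 0) \<le> 1 powr a * M / a - 0 powr a * M / a"
  proof (rule differentiable_bound_general[where
        f' = "\<lambda>t. (t powr (a - 1)) *\<^sub>R
          (of_real a * f (of_real t * z) + of_real t * z * deriv f (of_real t * z))" and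
        \<phi>' = "\<lambda>t. t powr (a - 1) * M"])
    show "continuous_on {0..1} \<phi>"
      unfolding \<phi>_def using in_ball
      by (intro continuous_on_scaleR cont_powr
          continuous_on_compose2[OF holomorphic_on_imp_continuous_on[OF hol]] continuous_intros)
         auto
    show "continuous_on {0..1} (\<lambda>t. t powr a * M / a)"
      using \<open>0 < a\<close> by (intro continuous_intros cont_powr) auto
    fix t :: real
    assume t: "0 < t" "t < 1"
    show "((\<lambda>t. t powr a * M / a) has_vector_derivative t powr (a - 1) * M) (at t)"
      unfolding has_real_derivative_iff_has_vector_derivative[symmetric]
      using t \<open>0 < a\<close> by (auto intro!: derivative_eq_intros)
    have "(f has_field_derivative deriv f (of_real t * z)) (at (of_real t * z))"
      using t by (intro holomorphic_derivI[OF hol] in_ball) auto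
    moreover have "((\<lambda>t. of_real t * z) has_vector_derivative z) (at t)"
      by (auto intro!: derivative_eq_intros)
    ultimately have "((\<lambda>t. f (of_real t * z)) has_vector_derivative
        z * deriv f (of_real t * z)) (at t)"
      using field_vector_diff_chain_at by (fastforce simp: o_def)
    moreover have "((\<lambda>t. t powr a) has_real_derivative a * t powr (a - 1)) (at t)"
      using t by (auto intro!: derivative_eq_intros)
    ultimately have "(\<phi> has_vector_derivative
        (t powr a) *\<^sub>R (z * deriv f (of_real t * z)) +
        (a * t powr (a - 1)) *\<^sub>R f (of_real t * z)) (at t)"
      unfolding \<phi>_def by (intro has_vector_derivative_scaleR)
    moreover have "t powr a = t powr (a - 1) * t"
      using t by (simp add: powr_diff)
    ultimately show "(\<phi> has_vector_derivative (t powr (a - 1)) *\<^sub>R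
        (of_real a * f (of_real t * z) + of_real t * z * deriv f (of_real t * z))) (at t)"
      by (simp add: scaleR_conv_of_real algebra_simps)
    show "norm ((t powr (a - 1)) *\<^sub>R
        (of_real a * f (of_real t * z) + of_real t * z * deriv f (of_real t * z)))
        \<le> t powr (a - 1) * M"
      using bnd[OF t] by (simp add: mult_left_mono)
  qed simp
  then show ?thesis
    using \<open>0 < a\<close> by (simp add: \<phi>_def)
qed

text \<open>Mean value inequality on the segment from 0 to \<open>z\<close>. The bound is asked for
  away from 0 because the theorem obtains it after dividing by \<open>z\<close>.\<close>

lemma norm_diff_origin_le:
  fixes f :: "complex \<Rightarrow> complex"
  assumes hol: "f holomorphic_on ball 0 r" and z: "norm z < r"
    and bnd: "\<And>w. w \<noteq> 0 \<Longrightarrow> norm w < r \<Longrightarrow> norm (deriv f w) \<le> B"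
  shows "norm (f z - f 0) \<le> B * norm z"
proof (cases "z = 0")
  case False
  have in_ball: "of_real t * z \<in> ball 0 r" if "0 \<le> t" "t \<le> 1" for t :: real
    using z that mult_left_le_one_le[of "norm z" t] by (simp add: norm_mult)
  have "norm (f (of_real 1 * z) - f (of_real 0 * z)) \<le> 1 * (B * norm z) - 0 * (B * norm z)"
  proof (rule differentiable_bound_general[where
        f' = "\<lambda>t. z * deriv f (of_real t * z)" and \<phi>' = "\<lambda>t. B * norm z"])
    show "continuous_on {0..1} (\<lambda>t. f (of_real t * z))"
      using in_ball
      by (intro continuous_on_compose2[OF holomorphic_on_imp_continuous_on[OF hol]]
          continuous_intros) auto
    show "continuous_on {0..1} (\<lambda>t. t * (B * norm z))"
      by (intro continuous_intros)
    fix t :: real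
    assume t: "0 < t" "t < 1"
    have "(f has_field_derivative deriv f (of_real t * z)) (at (of_real t * z))"
      using t by (intro holomorphic_derivI[OF hol] in_ball) auto
    moreover have "((\<lambda>t. of_real t * z) has_vector_derivative z) (at t)"
      by (auto intro!: derivative_eq_intros)
    ultimately show "((\<lambda>t. f (of_real t * z)) has_vector_derivative
        z * deriv f (of_real t * z)) (at t)"
      using field_vector_diff_chain_at by (fastforce simp: o_def)
    show "((\<lambda>t. t * (B * norm z)) has_vector_derivative B * norm z) (at t)"
      by (auto intro!: derivative_eq_intros)
    show "norm (z * deriv f (of_real t * z)) \<le> B * norm z"
      using bnd[of "of_real t * z"] in_ball[of t] t False
      by (simp add: norm_mult mult_right_mono mult.commute)
  qed simp
  then show ?thesis by simp
qed simp

theorem theorem3p8: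
  fixes \<beta>1 \<beta>2 :: real and p :: "complex \<Rightarrow> complex"
  assumes "\<beta>1 > 0" and "\<beta>2 > 0"
    and "2 * \<beta>1 - \<beta>2 \<ge> sqrt 2 * pi"
    and "p holomorphic_on ball 0 1" and "p 0 = 1"
    and "(\<lambda>z. 1 + of_real \<beta>1 * z * deriv p z + of_real \<beta>2 * z\<^sup>2 * deriv (deriv p) z)
           \<prec>\<^sub>D (\<lambda>z. 1 + arsinh z)"
  shows "p \<prec>\<^sub>D (\<lambda>z. 1 + arsinh z)"
proof -
  obtain w where w: "\<And>z. z \<in> ball 0 1 \<Longrightarrow> norm (w z) \<le> norm z"
    and eq: "\<And>z. z \<in> ball 0 1 \<Longrightarrow>
      of_real \<beta>1 * z * deriv p z + of_real \<beta>2 * z\<^sup>2 * deriv (deriv p) z = arsinh (w z)"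
    using assms(6) unfolding subordinate_def add.assoc add_left_cancel by blast
  have hol': "deriv p holomorphic_on ball 0 1"
    by (intro holomorphic_deriv assms) auto
  \<comment> \<open>Dividing the equation by \<open>\<beta>2 * z\<close> gives the radial form with
    a = \<open>\<beta>1 / \<beta>2\<close>; the factor \<open>norm z\<close> in the bound on
    \<open>arsinh (w z)\<close> cancels.\<close>
  have ode: "norm (of_real (\<beta>1 / \<beta>2) * deriv p z + z * deriv (deriv p) z) \<le> pi / (2 * \<beta>2)"
    if z: "z \<noteq> 0" "norm z < 1" for z
  proof -
    have "(\<beta>2 * norm z) * norm (of_real (\<beta>1 / \<beta>2) * deriv p z + z * deriv (deriv p) z)
        = norm (of_real \<beta>2 * z * (of_real (\<beta>1 / \<beta>2) * deriv p z + z * deriv (deriv p) z))"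
      using \<open>\<beta>2 > 0\<close> by (simp add: norm_mult)
    also have "of_real \<beta>2 * z * (of_real (\<beta>1 / \<beta>2) * deriv p z + z * deriv (deriv p) z)
        = arsinh (w z)"
      using \<open>\<beta>2 > 0\<close> z by (simp add: eq[symmetric] field_simps power2_eq_square)
    also have "norm (arsinh (w z)) \<le> pi / 2 * norm (w z)"
      using w[of z] z by (intro norm_arsinh_le) auto
    also have "\<dots> \<le> pi / 2 * norm z"
      using w[of z] z by (intro mult_left_mono) auto
    also have "\<dots> = (\<beta>2 * norm z) * (pi / (2 * \<beta>2))"
      using \<open>\<beta>2 > 0\<close> by simp
    finally show ?thesis
      using \<open>\<beta>2 > 0\<close> z by (subst (asm) mult_le_cancel_left_pos) auto
  qed
  \<comment> \<open>The target 1/sqrt 2 is the reciprocal of the constant in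
    \<open>norm_sin_le\<close>, so that the two cancel at the end.\<close>
  have \<beta>1: "pi / (2 * \<beta>1) \<le> 1 / sqrt 2"
  proof -
    have "sqrt 2 * pi \<le> 2 * \<beta>1"
      using assms by simp
    then show ?thesis
      using \<open>\<beta>1 > 0\<close> by (simp add: field_simps)
  qed
  have "norm (deriv p z) \<le> 1 / sqrt 2" if z: "z \<noteq> 0" "norm z < 1" for z
  proof -
    have "norm (deriv p z) \<le> pi / (2 * \<beta>2) / (\<beta>1 / \<beta>2)"
    proof (rule norm_le_of_radial_ode_bound[OF _ hol' z(2)])
      fix t :: real
      assume t: "0 < t" "t < 1"
      have "norm (of_real t * z) \<le> norm z"
        using t by (simp add: norm_mult mult_left_le_one_le)
      with t z show "norm (of_real (\<beta>1 / \<beta>2) * deriv p (of_real t * z)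
          + of_real t * z * deriv (deriv p) (of_real t * z)) \<le> pi / (2 * \<beta>2)"
        by (intro ode) auto
    qed (use assms in auto)
    also have "\<dots> = pi / (2 * \<beta>1)"
      using assms by simp
    finally show ?thesis
      using \<beta>1 by linarith
  qed
  then have bound: "norm (p z - 1) \<le> 1 / sqrt 2 * norm z" if "norm z < 1" for z
    using norm_diff_origin_le[OF assms(4) that, of "1 / sqrt 2"] \<open>p 0 = 1\<close> by simp
  \<comment> \<open>The rational 3/4 exceeds 1/sqrt 2, since 16/9 \<le> 2. It meets the requirement
    of \<open>norm_sin_le\<close> and stays below pi/2.\<close>
  have small: "norm (p z - 1) \<le> 3 / 4" if "norm z < 1" for z
  proof -
    have "1 / sqrt 2 \<le> (3 / 4 :: real)"
      using real_le_rsqrt[of "4 / 3" 2] by (simp add: field_simps power2_eq_square)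
    moreover have "1 / sqrt 2 * norm z \<le> 1 / sqrt 2"
      using that by (simp add: field_simps)
    ultimately show ?thesis
      using bound[OF that] by linarith
  qed
  \<comment> \<open>This is $\sinh(p(z) - 1)$, as $\sinh u = i \sin(-iu)$.\<close>
  define v where "v z = \<i> * sin (- \<i> * (p z - 1))" for z
  show ?thesis
    unfolding subordinate_def
  proof (intro exI[of _ v] conjI ballI)
    show "v holomorphic_on ball 0 1"
      unfolding v_def by (intro holomorphic_intros assms)
    show "v 0 = 0"
      by (simp add: v_def \<open>p 0 = 1\<close>)
  next
    fix z :: complex
    assume "z \<in> ball 0 1"
    then have z: "norm z < 1" by simp
    have "\<bar>Im (- \<i> * (p z - 1))\<bar> \<le> 3 / 4"
      using small[OF z] abs_Re_le_cmod[of "p z - 1"]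
      by (simp add: abs_minus_commute)
    from norm_sin_le[OF this] have "norm (v z) \<le> sqrt 2 * norm (p z - 1)"
      unfolding v_def by (simp add: norm_mult)
    also have "\<dots> \<le> norm z"
      using bound[OF z] by (simp add: field_simps)
    finally show "norm (v z) \<le> norm z" .
    \<comment> \<open>In this strip \<open>Arcsin\<close> is a left inverse of \<open>sin\<close>,
      so the principal branch of \<open>arsinh\<close> recovers \<open>p z - 1\<close> from
      \<open>v z\<close>.\<close>
    have "\<bar>Re (- \<i> * (p z - 1))\<bar> < pi / 2"
      using small[OF z] abs_Im_le_cmod[of "p z - 1"] pi_ge_two by simp
    then have "Arcsin (sin (- \<i> * (p z - 1))) = - \<i> * (p z - 1)"
      by (intro Arcsin_sin) auto
    moreover have "- \<i> * v z = sin (- \<i> * (p z - 1))"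
      by (simp add: v_def)
    ultimately have "arsinh (v z) = \<i> * (- \<i> * (p z - 1))"
      by (simp only: arsinh_conv_Arcsin)
    then show "p z = 1 + arsinh (v z)"
      by simp
  qed
qed

end
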